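(* Let $G$ be a linear algebraic group over an infinite field $\Bbbk$, let $V$ be a $G$-module, and let $p=\operatorname{char}(\Bbbk)\ge 0$. Let $r\ge 0$ be an integer and let $d\ge 1$ be an integer that is invertible in $\Bbbk$. Let $v\in V^{G}\setminus\{0\}$ be a nonzero fixed point and suppose there exists a homogeneous invariant $f\in \Bbbk[V]^G$ of degree $p^{r}d$ such that $f(v)\neq 0$. Then there exists a homogeneous invariant $\tilde{f}\in\Bbbk[V]^G$ of degree $p^{r}$ such that $\tilde{f}(v)\neq 0$. In particular, for any $v\in V^{G}$, the quantity $\epsilon(G,v)$ is either a power of $p$ (including $p^{0}=1$) or $\infty$.
   Context: $\Bbbk$ is an infinite field of any characteristic and $G$ is a linear algebraic group over $\Bbbk$. A $G$-module is a finite dimensional $\Bbbk$-vector space $V$ on which $G$ acts linearly and rationally. $V^G$ denotes the set of $v\in V$ fixed by all of $G$. $\Bbbk[V]=S(V^* )$ is the ring of polynomial functions $V\to\Bbbk$ (the symmetric algebra of the dual of $V$), graded by total degree, $\Bbbk[V]=\bigoplus_{d\ge 0}\Bbbk[V]_d$. $G$ acts on $\Bbbk[V]$ by $g(f):=f\circ g^{-1}$ for $g\in G$, $f\in\Bbbk[V]$, and this action preserves the grading. $\Bbbk[V]^G$ is the ring of invariants (the polynomials fixed by this action), and $\Bbbk[V]^G_d$ is its degree-$d$ homogeneous component. For $v\in V$, $$\epsilon(G,v):=\inf\{d\in\mathbb{N}_{>0}\mid \text{there exists } f\in\Bbbk[V]^G_d \text{ such that } f(v)\neq 0\},$$ where the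 infimum of the empty set is $\infty$. When $p=0$, the convention $p^0=1$ is used. *)

theory Defs
  imports
    "HOL-Analysis.Analysis"
    "HOL-Library.Function_Algebras"
    "HOL-Library.Extended_Nat"
begin

section \<open>Polynomial functions on a vector space\<close>

text \<open>
  Over an infinite field the symmetric algebra of the dual of \<open>V\<close> is identified with the ring of
  polynomial functions on \<open>V\<close>. Its component of degree \<open>d\<close> is spanned by the \<open>d\<close>-fold products of
  linear forms; for \<open>d = 0\<close> the product is empty and the span consists of the constant functions.
  The spans are taken in the space of all functions \<open>V \<rightarrow> k\<close>, with pointwise scalar multiplication.
\<close>

definition fun_scale :: "'k::field \<Rightarrow> ('v \<Rightarrow> 'k) \<Rightarrow> 'v \<Rightarrow> 'k" where
  "fun_scale c f = (\<lambda>v. c * f v)"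

lemma vector_space_fun_scale: "vector_space fun_scale"
  by unfold_locales (simp_all add: fun_scale_def fun_eq_iff algebra_simps)

definition hom_polys :: "('k::field \<Rightarrow> 'v::ab_group_add \<Rightarrow> 'v) \<Rightarrow> nat \<Rightarrow> ('v \<Rightarrow> 'k) set" where
  "hom_polys smul d =
     module.span fun_scale
       {\<lambda>v. \<Prod>i<d. l i v | l. \<forall>i<d. Vector_Spaces.linear smul (*) (l i)}"

definition polys :: "('k::field \<Rightarrow> 'v::ab_group_add \<Rightarrow> 'v) \<Rightarrow> ('v \<Rightarrow> 'k) set" where
  "polys smul = module.span fun_scale (\<Union>d. hom_polys smul d)"

section \<open>Linear algebraic groups\<close>

definition mat_scale :: "'k::field \<Rightarrow> 'k^'n^'n \<Rightarrow> 'k^'n^'n" where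
  "mat_scale c A = (\<chi> i j. c * A $ i $ j)"

lemma vector_space_mat_scale: "vector_space mat_scale"
  by unfold_locales (simp_all add: mat_scale_def vec_eq_iff algebra_simps)

text \<open>
  A linear algebraic group is a Zariski closed subgroup of \<open>GL\<^sub>n(k)\<close>, that is, a subgroup which is
  the set of common zeros in \<open>GL\<^sub>n(k)\<close> of some polynomials in the matrix entries.
\<close>

locale linear_algebraic_group =
  fixes G :: "('k::field^'n^'n) set"
  assumes zariski_closed:
      "\<exists>S \<subseteq> polys mat_scale. G = {A. invertible A \<and> (\<forall>q\<in>S. q A = 0)}"
    and one_closed: "mat 1 \<in> G"
    and mult_closed: "\<lbrakk>A \<in> G; B \<in> G\<rbrakk> \<Longrightarrow> A ** B \<in> G"
    and inv_closed: "A \<in> G \<Longrightarrow> matrix_inv A \<in> G"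

text \<open>
  The coordinate ring of \<open>GL\<^sub>n\<close> is generated by the matrix entries and the inverse of the
  determinant; the regular functions on \<open>G\<close> are the restrictions of its elements.
\<close>

definition regular_on :: "('k::field^'n^'n) set \<Rightarrow> ('k^'n^'n \<Rightarrow> 'k) \<Rightarrow> bool" where
  "regular_on G h \<longleftrightarrow> (\<exists>q\<in>polys mat_scale. \<exists>m. \<forall>A\<in>G. h A = q A / det A ^ m)"

section \<open>Modules and invariants\<close>

text \<open>
  The representation space \<open>V\<close> is the whole type \<open>'v\<close>. The action is rational when all its matrix
  coefficients are regular functions on \<open>G\<close>.
\<close>

locale G_module = linear_algebraic_group G + vector_space smul
  for G :: "('k::field^'n^'n) set"
    and smul :: "'k \<Rightarrow> 'v::ab_group_add \<Rightarrow> 'v"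
    and \<rho> :: "'k^'n^'n \<Rightarrow> 'v \<Rightarrow> 'v" +
  assumes finite_dim: "\<exists>B. finite B \<and> span B = UNIV"
    and action_linear: "A \<in> G \<Longrightarrow> Vector_Spaces.linear smul smul (\<rho> A)"
    and action_one: "\<rho> (mat 1) v = v"
    and action_mult: "\<lbrakk>A \<in> G; B \<in> G\<rbrakk> \<Longrightarrow> \<rho> (A ** B) v = \<rho> A (\<rho> B v)"
    and action_rational: "Vector_Spaces.linear smul (*) l \<Longrightarrow> regular_on G (\<lambda>A. l (\<rho> A v))"

definition fixed_points :: "('k::field^'n^'n) set \<Rightarrow> ('k^'n^'n \<Rightarrow> 'v \<Rightarrow> 'v) \<Rightarrow> 'v set" where
  "fixed_points G \<rho> = {v. \<forall>A\<in>G. \<rho> A v = v}"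

definition fun_action ::
    "('k::field^'n^'n \<Rightarrow> 'v \<Rightarrow> 'v) \<Rightarrow> 'k^'n^'n \<Rightarrow> ('v \<Rightarrow> 'k) \<Rightarrow> 'v \<Rightarrow> 'k" where
  "fun_action \<rho> A f = f \<circ> \<rho> (matrix_inv A)"

definition invariants ::
    "('k::field^'n^'n) set \<Rightarrow> ('k \<Rightarrow> 'v::ab_group_add \<Rightarrow> 'v) \<Rightarrow> ('k^'n^'n \<Rightarrow> 'v \<Rightarrow> 'v)
      \<Rightarrow> ('v \<Rightarrow> 'k) set" where
  "invariants G smul \<rho> = {f \<in> polys smul. \<forall>A\<in>G. fun_action \<rho> A f = f}"

definition hom_invariants ::
    "('k::field^'n^'n) set \<Rightarrow> ('k \<Rightarrow> 'v::ab_group_add \<Rightarrow> 'v) \<Rightarrow> ('k^'n^'n \<Rightarrow> 'v \<Rightarrow> 'v)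
      \<Rightarrow> nat \<Rightarrow> ('v \<Rightarrow> 'k) set" where
  "hom_invariants G smul \<rho> d = invariants G smul \<rho> \<inter> hom_polys smul d"

text \<open>In \<^typ>\<open>enat\<close> the infimum of the empty set is \<open>\<infinity>\<close>.\<close>

definition epsilon ::
    "('k::field^'n^'n) set \<Rightarrow> ('k \<Rightarrow> 'v::ab_group_add \<Rightarrow> 'v) \<Rightarrow> ('k^'n^'n \<Rightarrow> 'v \<Rightarrow> 'v)
      \<Rightarrow> 'v \<Rightarrow> enat" where
  "epsilon G smul \<rho> v =
     Inf {enat d | d. d > 0 \<and> (\<exists>f\<in>hom_invariants G smul \<rho> d. f v \<noteq> 0)}"

end

theory Submission
  imports Defs "HOL-Algebra.Exponent"
begin

text \<open>
  Let \<open>f\<close> be a homogeneous invariant of degree \<open>n = p\<^sup>r d\<close> with \<open>f v \<noteq> 0\<close>. Expanding \<open>f (w + t v)\<close> in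
  powers of \<open>t\<close> gives \<open>f (w + t v) = (\<Sum>j\<le>n. t\<^sup>n\<^sup>-\<^sup>j g\<^sub>j w)\<close> with \<open>g\<^sub>j\<close> homogeneous of degree \<open>j\<close>
  (lemma \<open>hom_polys_expansion\<close>). Moving \<open>w\<close> by the group moves \<open>w + t v\<close> in the same way, because
  \<open>v\<close> is fixed; as \<open>f\<close> is invariant and a polynomial over an infinite field is determined by
  its values, every \<open>g\<^sub>j\<close> is invariant. At \<open>w = v\<close> homogeneity turns the expansion into
  \<open>(1 + t)\<^sup>n f v\<close>, whence \<open>g\<^sub>j v\<close> is \<open>n choose j\<close> times \<open>f v\<close>. These two facts are
  lemma \<open>polarized_invariant\<close>.

  It remains to take \<open>j = p\<^sup>r\<close>. If \<open>p > 0\<close>, the binomial coefficient \<open>p\<^sup>r d choose p\<^sup>r\<close> contains the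
  prime \<open>p\<close> exactly as often as \<open>d\<close> does, that is, not at all, so it is nonzero in the field. In
  characteristic zero it is a positive integer, and so again nonzero. For the statement on
  \<open>\<epsilon>\<close>, write the least degree as \<open>p\<^sup>r d\<close> with \<open>d\<close> invertible in the field (in characteristic
  zero with \<open>r = 0\<close>); by the first part \<open>p\<^sup>r\<close> is also such a degree, and minimality forces
  \<open>d = 1\<close>.
\<close>

section \<open>Homogeneous polynomial functions\<close>

interpretation fun_space: vector_space "fun_scale :: 'k::field \<Rightarrow> ('v \<Rightarrow> 'k) \<Rightarrow> 'v \<Rightarrow> 'k"
  by (rule vector_space_fun_scale)

lemma subspace_hom_polys: "fun_space.subspace (hom_polys smul d)"
  unfolding hom_polys_def by (rule fun_space.subspace_span)

lemma hom_polys_subset_polys: "hom_polys smul d \<subseteq> polys smul"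
  unfolding polys_def by (meson UN_I UNIV_I fun_space.span_base subsetI)

lemma prod_linear_in_hom_polys:
  assumes "finite S" "\<And>i. i \<in> S \<Longrightarrow> Vector_Spaces.linear smul (*) (l i)"
  shows "(\<lambda>w. \<Prod>i\<in>S. l i w) \<in> hom_polys smul (card S)"
proof -
  obtain e where e: "bij_betw e {..<card S} S"
    using ex_bij_betw_nat_finite[OF assms(1)] by (auto simp: atLeast0LessThan)
  have "(\<lambda>w. \<Prod>i\<in>S. l i w) = (\<lambda>w. \<Prod>i<card S. (l \<circ> e) i w)"
    by (simp add: prod.reindex_bij_betw[OF e, symmetric])
  moreover have "\<forall>i<card S. Vector_Spaces.linear smul (*) ((l \<circ> e) i)"
    using assms(2) bij_betwE[OF e] by auto
  ultimately show ?thesis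
    unfolding hom_polys_def by (intro fun_space.span_base) blast
qed

lemma hom_polys_homogeneous:
  fixes smul :: "'k::field \<Rightarrow> 'v::ab_group_add \<Rightarrow> 'v"
  assumes "f \<in> hom_polys smul n"
  shows "f (smul c w) = c ^ n * f w"
proof -
  have sub: "fun_space.subspace {f. f (smul c w) = c ^ n * f w}"
    by (rule fun_space.subspaceI) (auto simp: fun_scale_def algebra_simps)
  have "{\<lambda>v. \<Prod>i<n. l i v | l. \<forall>i<n. Vector_Spaces.linear smul (*) (l i)}
      \<subseteq> {f. f (smul c w) = c ^ n * f w}"
  proof clarify
    fix l :: "nat \<Rightarrow> 'v \<Rightarrow> 'k"
    assume "\<forall>i<n. Vector_Spaces.linear smul (*) (l i)"
    then have "(\<Prod>i<n. l i (smul c w)) = (\<Prod>i<n. c * l i w)"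
      by (intro prod.cong) (auto simp: linear_iff_module_hom module_hom.scale)
    then show "(\<Prod>i<n. l i (smul c w)) = c ^ n * (\<Prod>i<n. l i w)"
      by (simp add: prod.distrib)
  qed
  with fun_space.span_minimal[OF _ sub] assms show ?thesis
    unfolding hom_polys_def by blast
qed

text \<open>
  The coefficients for a product of linear forms come from multiplying out: a subset \<open>S\<close> of the
  factors contributes \<open>w\<close>, its complement contributes \<open>t v\<close>, and \<open>g\<^sub>j\<close> collects the subsets of
  size \<open>j\<close>. The existence of such coefficients is stable under linear combinations of \<open>f\<close>.
\<close>

lemma hom_polys_expansion:
  fixes smul :: "'k::field \<Rightarrow> 'v::ab_group_add \<Rightarrow> 'v"
  assumes "f \<in> hom_polys smul n"
  obtains g where "\<And>j. g j \<in> hom_polys smul j"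
    and "\<And>w t. f (w + smul t v) = (\<Sum>j\<le>n. t ^ (n - j) * g j w)"
proof -
  define E where "E = {f. \<exists>g. (\<forall>j. g j \<in> hom_polys smul j) \<and>
    (\<forall>w t. f (w + smul t v) = (\<Sum>j\<le>n. t ^ (n - j) * g j w))}"
  have sub: "fun_space.subspace E"
  proof (rule fun_space.subspaceI)
    show "0 \<in> E"
      unfolding E_def
      by (auto intro!: exI[of _ "\<lambda>_. 0"] fun_space.subspace_0[OF subspace_hom_polys])
  next
    fix f1 f2 assume "f1 \<in> E" "f2 \<in> E"
    then obtain g1 g2 where
      "\<forall>j. g1 j \<in> hom_polys smul j" "\<forall>j. g2 j \<in> hom_polys smul j"
      "\<forall>w t. f1 (w + smul t v) = (\<Sum>j\<le>n. t ^ (n - j) * g1 j w)"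
      "\<forall>w t. f2 (w + smul t v) = (\<Sum>j\<le>n. t ^ (n - j) * g2 j w)"
      unfolding E_def by blast
    then show "f1 + f2 \<in> E"
      unfolding E_def
      by (auto intro!: exI[of _ "\<lambda>j. g1 j + g2 j"] fun_space.subspace_add[OF subspace_hom_polys]
          simp: sum.distrib distrib_left)
  next
    fix c f1 assume "f1 \<in> E"
    then obtain g1 where
      "\<forall>j. g1 j \<in> hom_polys smul j"
      "\<forall>w t. f1 (w + smul t v) = (\<Sum>j\<le>n. t ^ (n - j) * g1 j w)"
      unfolding E_def by blast
    moreover from this(1) have "\<forall>j. fun_scale c (g1 j) \<in> hom_polys smul j"
      using fun_space.subspace_scale[OF subspace_hom_polys] by blast
    ultimately show "fun_scale c f1 \<in> E"
      unfolding E_def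
      by (auto intro!: exI[of _ "\<lambda>j. fun_scale c (g1 j)"]
          simp: fun_scale_def sum_distrib_left mult.left_commute)
  qed
  have "{\<lambda>v. \<Prod>i<n. l i v | l. \<forall>i<n. Vector_Spaces.linear smul (*) (l i)} \<subseteq> E"
  proof clarify
    fix l :: "nat \<Rightarrow> 'v \<Rightarrow> 'k"
    assume lin: "\<forall>i<n. Vector_Spaces.linear smul (*) (l i)"
    define sets where "sets j = {S \<in> Pow {..<n}. card S = j}" for j
    define coef where "coef S = (\<Prod>i\<in>{..<n} - S. l i v)" for S
    define g where "g j = (\<Sum>S\<in>sets j. fun_scale (coef S) (\<lambda>w. \<Prod>i\<in>S. l i w))" for j
    have g_eq: "g j w = (\<Sum>S\<in>sets j. coef S * (\<Prod>i\<in>S. l i w))" for j w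
    proof -
      have "sum h A w = (\<Sum>S\<in>A. h S w)" for h :: "nat set \<Rightarrow> 'v \<Rightarrow> 'k" and A
        by (induction A rule: infinite_finite_induct) auto
      then show ?thesis by (simp add: g_def fun_scale_def)
    qed
    have "g j \<in> hom_polys smul j" for j
      unfolding g_def
    proof (intro fun_space.subspace_sum[OF subspace_hom_polys]
        fun_space.subspace_scale[OF subspace_hom_polys])
      fix S assume "S \<in> sets j"
      then have S: "S \<subseteq> {..<n}" "card S = j" by (auto simp: sets_def)
      then have "finite S" by (meson finite_lessThan finite_subset)
      with S lin prod_linear_in_hom_polys[of S smul l]
      show "(\<lambda>w. \<Prod>i\<in>S. l i w) \<in> hom_polys smul j" by auto
    qed
    moreover have "(\<Prod>i<n. l i (w + smul t v)) = (\<Sum>j\<le>n. t ^ (n - j) * g j w)" for w t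
    proof -
      have "(\<Prod>i<n. l i (w + smul t v)) = (\<Prod>i<n. l i w + t * l i v)"
        using lin by (intro prod.cong)
          (auto simp: linear_iff_module_hom module_hom.add module_hom.scale)
      also have "\<dots> = (\<Sum>S\<in>Pow {..<n}. (\<Prod>i\<in>S. l i w) * (\<Prod>i\<in>{..<n} - S. t * l i v))"
        by (rule prod_add) simp
      also have "\<dots> = (\<Sum>S\<in>Pow {..<n}. t ^ (n - card S) * (coef S * (\<Prod>i\<in>S. l i w)))"
        by (intro sum.cong) (auto simp: coef_def prod.distrib card_Diff_subset finite_subset)
      also have "\<dots> = (\<Sum>j\<le>n. \<Sum>S\<in>sets j. t ^ (n - card S) * (coef S * (\<Prod>i\<in>S. l i w)))"
        unfolding sets_def
        by (rule sum.group[symmetric]) (auto dest: card_mono[OF finite_lessThan])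
      also have "\<dots> = (\<Sum>j\<le>n. t ^ (n - j) * g j w)"
        unfolding g_eq sum_distrib_left by (intro sum.cong) (auto simp: sets_def)
      finally show ?thesis .
    qed
    ultimately show "(\<lambda>v. \<Prod>i<n. l i v) \<in> E"
      unfolding E_def by blast
  qed
  with fun_space.span_minimal[OF _ sub] assms have "f \<in> E"
    unfolding hom_polys_def by blast
  with that show ?thesis unfolding E_def by blast
qed

section \<open>Invariants obtained by expanding around a fixed point\<close>

lemma coeffs_eq_if_values_eq:
  fixes a b :: "nat \<Rightarrow> 'k::field"
  assumes "infinite (UNIV :: 'k set)"
    and "\<And>t. (\<Sum>j\<le>n. t ^ (n - j) * a j) = (\<Sum>j\<le>n. t ^ (n - j) * b j)"
    and "j \<le> n"
  shows "a j = b j"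
proof -
  define P where "P = (\<Sum>j\<le>n. monom (a j - b j) (n - j))"
  have "poly P t = 0" for t
    using assms(2)[of t]
    by (simp add: P_def poly_sum poly_monom algebra_simps sum_subtractf)
  then have "P = 0"
    using poly_roots_finite[of P] assms(1) by auto
  then have "0 = coeff P (n - j)" by simp
  also have "\<dots> = (\<Sum>i\<le>n. if i = j then a i - b i else 0)"
    unfolding P_def coeff_sum coeff_monom using assms(3) by (intro sum.cong) auto
  also have "\<dots> = a j - b j"
    using assms(3) by simp
  finally show ?thesis by simp
qed

text \<open>
  The coefficient \<open>g\<close> of \<open>t\<^sup>n\<^sup>-\<^sup>j\<close> in \<open>f (w + t v)\<close>, as a function of \<open>w\<close>, inherits invariance from \<open>f\<close> because
  \<open>\<rho> B (w + t v) = \<rho> B w + t v\<close> for every \<open>B\<close> in the group: the expansions of \<open>f\<close> at \<open>\<rho> B w\<close> and at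
  \<open>w\<close> are the same polynomial in \<open>t\<close>. Its value at \<open>v\<close> is read off from
  \<open>f ((1 + t) v) = (1 + t)\<^sup>n f v\<close>.
\<close>

lemma polarized_invariant:
  fixes G :: "('k::field^'n^'n) set"
  assumes inf: "infinite (UNIV :: 'k set)" and "G_module G smul \<rho>"
    and v: "v \<in> fixed_points G \<rho>" and f: "f \<in> hom_invariants G smul \<rho> n" and "j \<le> n"
  shows "\<exists>g\<in>hom_invariants G smul \<rho> j. g v = of_nat (n choose j) * f v"
proof -
  interpret G_module G smul \<rho> by fact
  from f have f_hom: "f \<in> hom_polys smul n"
    and f_inv: "\<And>A. A \<in> G \<Longrightarrow> fun_action \<rho> A f = f"
    by (auto simp: hom_invariants_def invariants_def)
  obtain g where g: "\<And>j. g j \<in> hom_polys smul j"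
    and expand: "\<And>w t. f (w + smul t v) = (\<Sum>j\<le>n. t ^ (n - j) * g j w)"
    using hom_polys_expansion[OF f_hom] by metis
  have "fun_action \<rho> A (g j) = g j" if "A \<in> G" for A
  proof
    fix w
    let ?B = "matrix_inv A"
    have B: "?B \<in> G" using inv_closed[OF that] .
    have "\<rho> ?B (w + smul t v) = \<rho> ?B w + smul t v" for t
      using action_linear[OF B] v B
      by (simp add: fixed_points_def linear_iff_module_hom module_hom.add module_hom.scale)
    then have "f (\<rho> ?B w + smul t v) = f (w + smul t v)" for t
      using fun_cong[OF f_inv[OF that], of "w + smul t v"] by (simp add: fun_action_def)
    then have "g j (\<rho> ?B w) = g j w"
      unfolding expand by (rule coeffs_eq_if_values_eq[OF inf _ \<open>j \<le> n\<close>])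
    then show "fun_action \<rho> A (g j) w = g j w" by (simp add: fun_action_def)
  qed
  with g hom_polys_subset_polys have "g j \<in> hom_invariants G smul \<rho> j"
    by (auto simp: hom_invariants_def invariants_def)
  moreover have "g j v = of_nat (n choose j) * f v"
  proof (rule coeffs_eq_if_values_eq[OF inf _ \<open>j \<le> n\<close>])
    fix t
    have "(\<Sum>j\<le>n. t ^ (n - j) * g j v) = f (smul (1 + t) v)"
      unfolding expand[symmetric] by (simp add: scale_left_distrib)
    also have "\<dots> = (1 + t) ^ n * f v"
      by (rule hom_polys_homogeneous[OF f_hom])
    also have "\<dots> = (\<Sum>j\<le>n. t ^ (n - j) * (of_nat (n choose j) * f v))"
      by (simp add: binomial_ring sum_distrib_left mult_ac)
    finally show "(\<Sum>j\<le>n. t ^ (n - j) * g j v)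
        = (\<Sum>j\<le>n. t ^ (n - j) * (of_nat (n choose j) * f v))" .
  qed
  ultimately show ?thesis by blast
qed

section \<open>Degrees and the characteristic\<close>

text \<open>
  In positive characteristic this rests on Kummer's carry count in its simplest case: the
  multiplicities of a prime \<open>p\<close> in \<open>p\<^sup>r d choose p\<^sup>r\<close> and in \<open>d\<close> agree.
\<close>

lemma binomial_CHAR_power_nonzero:
  assumes "(of_nat d :: 'k::field) \<noteq> 0"
  shows "(of_nat (CHAR('k) ^ r * d choose CHAR('k) ^ r) :: 'k) \<noteq> 0"
proof (cases "CHAR('k) = 0")
  case True
  \<comment> \<open>Here \<open>CHAR('k) ^ r\<close> is \<open>1\<close> or \<open>0\<close>, and the binomial coefficient is \<open>d\<close> or \<open>1\<close>.\<close>
  with assms show ?thesis by (cases r) auto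
next
  case False
  then have p: "prime CHAR('k)" using prime_CHAR_semidom by blast
  have d: "d > 0" using assms by (cases d) auto
  have "\<not> CHAR('k) dvd d" using assms by (simp add: of_nat_eq_0_iff_char_dvd)
  then have "multiplicity CHAR('k) (CHAR('k) ^ r * d choose CHAR('k) ^ r) = 0"
    using const_p_fac[OF d p] by (simp add: not_dvd_imp_multiplicity_0)
  moreover have "(CHAR('k) ^ r * d choose CHAR('k) ^ r) \<noteq> 0"
    using d by simp
  ultimately show ?thesis
    using p by (simp add: of_nat_eq_0_iff_char_dvd multiplicity_eq_zero_iff)
qed

lemma CHAR_decomposition:
  assumes "n > 0"
  obtains r d where "n = CHAR('k::field) ^ r * d" "(of_nat d :: 'k) \<noteq> 0"
proof (cases "CHAR('k) = 0")
  case True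
  with assms that[of 0 n] show ?thesis by (simp add: of_nat_eq_0_iff_char_dvd)
next
  case False
  then have "prime CHAR('k)" using prime_CHAR_semidom by blast
  then have "\<not> is_unit CHAR('k)" using not_prime_unit by blast
  with assms obtain d where "n = CHAR('k) ^ multiplicity CHAR('k) n * d" "\<not> CHAR('k) dvd d"
    using multiplicity_decompose'[of n "CHAR('k)"] by auto
  with that show ?thesis by (simp add: of_nat_eq_0_iff_char_dvd)
qed

lemma hom_invariant_of_CHAR_power_degree:
  fixes G :: "('k::field^'n^'n) set"
  assumes "infinite (UNIV :: 'k set)" "G_module G smul \<rho>" "v \<in> fixed_points G \<rho>"
    and d: "(of_nat d :: 'k) \<noteq> 0"
    and f: "f \<in> hom_invariants G smul \<rho> (CHAR('k) ^ r * d)" "f v \<noteq> 0"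
  shows "\<exists>f'\<in>hom_invariants G smul \<rho> (CHAR('k) ^ r). f' v \<noteq> 0"
proof -
  have "d > 0" using d by (cases d) auto
  then have "CHAR('k) ^ r \<le> CHAR('k) ^ r * d" by simp
  from polarized_invariant[OF assms(1-3) f(1) this]
  obtain g where "g \<in> hom_invariants G smul \<rho> (CHAR('k) ^ r)"
    "g v = of_nat (CHAR('k) ^ r * d choose CHAR('k) ^ r) * f v" by blast
  moreover have "of_nat (CHAR('k) ^ r * d choose CHAR('k) ^ r) * f v \<noteq> 0"
    using binomial_CHAR_power_nonzero[OF d] f(2) by (rule no_zero_divisors)
  ultimately show ?thesis by (intro bexI[of _ g]) (simp_all only: not_False_eq_True)
qed

lemma epsilon_attained:
  assumes "epsilon G smul \<rho> v \<noteq> \<infinity>"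
  obtains n f where "epsilon G smul \<rho> v = enat n" "n > 0"
    "f \<in> hom_invariants G smul \<rho> n" "f v \<noteq> 0"
proof -
  let ?D = "{enat d | d. d > 0 \<and> (\<exists>f\<in>hom_invariants G smul \<rho> d. f v \<noteq> 0)}"
  have "?D \<noteq> {}"
    using assms unfolding epsilon_def by (metis (no_types, lifting) Inf_empty top_enat_def)
  then obtain k where "k \<in> ?D" by (meson ex_in_conv)
  then have "Inf ?D \<in> ?D" by (rule wellorder_InfI)
  with that show ?thesis unfolding epsilon_def by blast
qed

lemma epsilon_le:
  assumes "f \<in> hom_invariants G smul \<rho> d" "f v \<noteq> 0" "d > 0"
  shows "epsilon G smul \<rho> v \<le> enat d"
  unfolding epsilon_def using assms by (intro Inf_lower) blast

theorem theorem1p1: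
  fixes G :: "('k::field^'n^'n) set"
    and smul :: "'k \<Rightarrow> 'v::ab_group_add \<Rightarrow> 'v"
    and \<rho> :: "'k^'n^'n \<Rightarrow> 'v \<Rightarrow> 'v"
  assumes "infinite (UNIV :: 'k set)"
    and "G_module G smul \<rho>"
  shows "(\<forall>r d v. d \<ge> 1 \<longrightarrow> (of_nat d :: 'k) dvd 1 \<longrightarrow> v \<in> fixed_points G \<rho> - {0} \<longrightarrow>
             (\<exists>f\<in>hom_invariants G smul \<rho> (CHAR('k) ^ r * d). f v \<noteq> 0) \<longrightarrow>
             (\<exists>f'\<in>hom_invariants G smul \<rho> (CHAR('k) ^ r). f' v \<noteq> 0)) \<and>
         (\<forall>v\<in>fixed_points G \<rho>.
             (\<exists>r. epsilon G smul \<rho> v = enat (CHAR('k) ^ r)) \<or> epsilon G smul \<rho> v = \<infinity>)"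
proof (intro conjI allI impI ballI)
  fix r d v
  assume "(of_nat d :: 'k) dvd 1" "v \<in> fixed_points G \<rho> - {0}"
    "\<exists>f\<in>hom_invariants G smul \<rho> (CHAR('k) ^ r * d). f v \<noteq> 0"
  moreover from this(1) have "(of_nat d :: 'k) \<noteq> 0" by auto
  ultimately show "\<exists>f'\<in>hom_invariants G smul \<rho> (CHAR('k) ^ r). f' v \<noteq> 0"
    using hom_invariant_of_CHAR_power_degree[OF assms] by blast
next
  fix v assume v: "v \<in> fixed_points G \<rho>"
  show "(\<exists>r. epsilon G smul \<rho> v = enat (CHAR('k) ^ r)) \<or> epsilon G smul \<rho> v = \<infinity>"
  proof (rule disjCI)
    assume "epsilon G smul \<rho> v \<noteq> \<infinity>"
    then obtain n f where n: "epsilon G smul \<rho> v = enat n" "n > 0"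
      and f: "f \<in> hom_invariants G smul \<rho> n" "f v \<noteq> 0"
      by (rule epsilon_attained)
    obtain r d where rd: "n = CHAR('k) ^ r * d" "(of_nat d :: 'k) \<noteq> 0"
      using CHAR_decomposition[OF n(2)] by metis
    have pos: "CHAR('k) ^ r > 0" "d > 0" using n(2) rd(1) by auto
    obtain f' where "f' \<in> hom_invariants G smul \<rho> (CHAR('k) ^ r)" "f' v \<noteq> 0"
      using hom_invariant_of_CHAR_power_degree[OF assms v rd(2)] f rd(1) by blast
    then have "n \<le> CHAR('k) ^ r"
      using epsilon_le pos(1) n(1) by (metis enat_ord_simps(1))
    moreover have "CHAR('k) ^ r \<le> n" using rd(1) pos(2) by simp
    ultimately show "\<exists>r. epsilon G smul \<rho> v = enat (CHAR('k) ^ r)"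
      using n(1) by (metis le_antisym)
  qed
qed

end
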